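(* Let $\delta\in(0,1]$, $\eta>0$, $\alpha\in[0,1]$, and let $T\ge 1$ be an integer. Let $(p_t)_{t\ge1}$ be a sequence of $p$-values and let $\mathcal H^0\subseteq\{1,2,\dots\}$ be the (non-random) set of indices of truly null hypotheses. Let the decision thresholds be $\alpha_t=f_t(R_1,\dots,R_{t-1})\ge 0$, where $R_t=\mathbf 1\{p_t\le\alpha_t\}$ and each function $f_t:\{0,1\}^{t-1}\to[0,\infty)$ is coordinatewise non-decreasing. Assume that for every $t\in\mathcal H^0$, $p_t$ is independent of $(p_s)_{s\neq t}$ and $$\Pr\{p_t\le u\mid \mathcal F^{t-1}\}\le u\quad\text{for all }u\in[0,1],\qquad \mathcal F^{t-1}=\sigma(R_1,\dots,R_{t-1}).$$ If the thresholds are such that, almost surely, $$\widehat{\mathrm{FDP}}{}^{\delta}_{\mathrm{LORD}}(T)=\frac{\sum_{t\le T}\delta^{T-t}\alpha_t}{R_\delta(T)+\eta}\le\alpha,$$ then $$\mathrm{sFDR}_\delta(T)=\mathbf E\left[\frac{V_\delta(T)}{R_\delta(T)+\eta}\right]\le\alpha.$$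
   Context: At each time $t$ a hypothesis $H_t$ is tested using a $[0,1]$-valued random variable $p_t$ (the $p$-value), and it is rejected when $p_t\le\alpha_t$. The rejection indicator is $R_t=\mathbf 1\{p_t\le\alpha_t\}$. The decaying-memory counts of rejections and false positives are $$R_\delta(T)=\sum_{t=1}^T\delta^{T-t}R_t,\qquad V_\delta(T)=\sum_{t=1}^T\delta^{T-t}R_t\,\mathbf 1\{t\in\mathcal H^0\}.$$ *)

theory Defs
  imports "HOL-Probability.Probability"
begin

text \<open>Time starts at 1 throughout; the index 0 of a sequence is never used.\<close>

definition rejection :: "(nat \<Rightarrow> 'a \<Rightarrow> real) \<Rightarrow> (nat \<Rightarrow> 'a \<Rightarrow> real) \<Rightarrow> nat \<Rightarrow> 'a \<Rightarrow> real" where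
  "rejection p a t \<omega> = (if p t \<omega> \<le> a t \<omega> then 1 else 0)"

definition mem_rejections :: "real \<Rightarrow> (nat \<Rightarrow> 'a \<Rightarrow> real) \<Rightarrow> nat \<Rightarrow> 'a \<Rightarrow> real" where
  "mem_rejections \<delta> R T \<omega> = (\<Sum>t=1..T. \<delta> ^ (T - t) * R t \<omega>)"

definition mem_false_positives ::
    "real \<Rightarrow> nat set \<Rightarrow> (nat \<Rightarrow> 'a \<Rightarrow> real) \<Rightarrow> nat \<Rightarrow> 'a \<Rightarrow> real" where
  "mem_false_positives \<delta> H0 R T \<omega> = (\<Sum>t=1..T. \<delta> ^ (T - t) * R t \<omega> * indicator H0 t)"

definition FDP_LORD ::
    "real \<Rightarrow> real \<Rightarrow> (nat \<Rightarrow> 'a \<Rightarrow> real) \<Rightarrow> (nat \<Rightarrow> 'a \<Rightarrow> real) \<Rightarrow> nat \<Rightarrow> 'a \<Rightarrow> real" where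
  "FDP_LORD \<delta> \<eta> a R T \<omega> =
     (\<Sum>t=1..T. \<delta> ^ (T - t) * a t \<omega>) / (mem_rejections \<delta> R T \<omega> + \<eta>)"

definition sFDR ::
    "'a measure \<Rightarrow> real \<Rightarrow> real \<Rightarrow> nat set \<Rightarrow> (nat \<Rightarrow> 'a \<Rightarrow> real) \<Rightarrow> nat \<Rightarrow> real" where
  "sFDR M \<delta> \<eta> H0 R T =
     (\<integral>\<omega>. mem_false_positives \<delta> H0 R T \<omega> / (mem_rejections \<delta> R T \<omega> + \<eta>) \<partial>M)"

text \<open>The \<open>\<sigma>\<close>-algebra on the space of \<open>M\<close> generated by the variables \<open>X s\<close>, \<open>s \<in> I\<close>.
  Being built by \<^const>\<open>sigma\<close>, it carries no meaningful measure; \<^const>\<open>real_cond_exp\<close> uses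
  only the space and the sets of its second argument.\<close>

definition generated :: "'a measure \<Rightarrow> (nat \<Rightarrow> 'a \<Rightarrow> real) \<Rightarrow> nat set \<Rightarrow> 'a measure" where
  "generated M X I = sigma (space M) (\<Union>s\<in>I. {X s -` B \<inter> space M |B. B \<in> sets borel})"

text \<open>\<open>{0,1}\<^sup>t\<^sup>-\<^sup>1\<close>, as extensional functions on the index set \<open>{1..<t}\<close>.\<close>

definition histories :: "nat \<Rightarrow> (nat \<Rightarrow> real) set" where
  "histories t = {1..<t} \<rightarrow>\<^sub>E {0, 1}"

definition coordwise_nondecreasing :: "nat \<Rightarrow> ((nat \<Rightarrow> real) \<Rightarrow> real) \<Rightarrow> bool" where
  "coordwise_nondecreasing t g \<longleftrightarrow>
     (\<forall>r\<in>histories t. \<forall>r'\<in>histories t. (\<forall>s\<in>{1..<t}. r s \<le> r' s) \<longrightarrow> g r \<le> g r')"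

end

theory Submission
  imports Defs
begin

text \<open>
  A null time \<open>t\<close> is handled by a leave-one-out argument: replace \<open>p\<^sub>t\<close> by \<open>0\<close>, which forces a
  rejection at time \<open>t\<close>. This leaves \<open>\<alpha>\<^sub>t\<close> unchanged; by monotonicity of the thresholds it can only
  increase the rejection count, and it changes nothing on the event \<open>R\<^sub>t = 1\<close>. The modified history
  is a function of the other \<open>p\<close>-values, hence independent of \<open>p\<^sub>t\<close>, so that superuniformity gives
  \<open>E[R\<^sub>t / (R\<^sub>\<delta>(T) + \<eta>)] \<le> E[\<alpha>\<^sub>t / (R\<^sub>\<delta>(T) + \<eta>)]\<close>. Summing over \<open>t\<close> bounds the sFDR by the expectation
  of the LORD estimate.
\<close>

section \<open>Superuniformity against an independent, finitely valued threshold\<close>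

text \<open>On the event \<open>Y = h\<close> both threshold and weight are constants, and by
  independence \<open>X \<le> g h\<close> has its unconditional probability there, at most
  \<open>g h\<close>. As \<open>S\<close> is finite, conditioning on \<open>Y\<close> is a finite
  sum over values. Below, \<open>X\<close> is a null p-value, \<open>Y\<close> the modified history
  and \<open>w\<close> the reciprocal denominator.\<close>

lemma (in prob_space) expectation_threshold_le:
  fixes X :: "'a \<Rightarrow> real" and Y :: "'a \<Rightarrow> 'b" and g w :: "'b \<Rightarrow> real"
  assumes X: "X \<in> borel_measurable M"
    and Y: "Y \<in> measurable M (count_space S)" and S: "finite S"
    and g: "\<And>h. h \<in> S \<Longrightarrow> 0 \<le> g h" and w: "\<And>h. h \<in> S \<Longrightarrow> 0 \<le> w h"
    and indep: "\<And>h u. h \<in> S \<Longrightarrow>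
      prob ({\<omega> \<in> space M. X \<omega> \<le> u} \<inter> {\<omega> \<in> space M. Y \<omega> = h})
        = prob {\<omega> \<in> space M. X \<omega> \<le> u} * prob {\<omega> \<in> space M. Y \<omega> = h}"
    and superuniform: "\<And>u. 0 \<le> u \<Longrightarrow> prob {\<omega> \<in> space M. X \<omega> \<le> u} \<le> u"
  shows "(\<integral>\<omega>. of_bool (X \<omega> \<le> g (Y \<omega>)) * w (Y \<omega>) \<partial>M) \<le> (\<integral>\<omega>. g (Y \<omega>) * w (Y \<omega>) \<partial>M)"
proof -
  let ?A = "\<lambda>u. {\<omega> \<in> space M. X \<omega> \<le> u}" and ?B = "\<lambda>h. {\<omega> \<in> space M. Y \<omega> = h}"
  have A: "?A u \<in> events" for u
    using X by measurable
  have B: "?B h \<in> events" if "h \<in> S" for h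
  proof -
    have "?B h = Y -` {h} \<inter> space M" by auto
    then show ?thesis using measurable_sets[OF Y, of "{h}"] that by simp
  qed
  have Y_in: "Y \<omega> \<in> S" if "\<omega> \<in> space M" for \<omega>
    using measurable_space[OF Y that] by simp
  \<comment> \<open>Only the summand \<open>h = Y \<omega>\<close> survives. \<open>F\<close> may
    also depend on \<open>\<omega>\<close>, so that the event on \<open>X\<close> can be part of
    it.\<close>
  have split: "F \<omega> (Y \<omega>) = (\<Sum>h\<in>S. F \<omega> h * indicator (?B h) \<omega>)"
    if "\<omega> \<in> space M" for F :: "'a \<Rightarrow> 'b \<Rightarrow> real" and \<omega>
    using that S Y_in[OF that] by (subst sum.remove[of S "Y \<omega>"]) (auto intro!: sum.neutral)
  have "(\<integral>\<omega>. of_bool (X \<omega> \<le> g (Y \<omega>)) * w (Y \<omega>) \<partial>M)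
      = (\<integral>\<omega>. (\<Sum>h\<in>S. w h * indicator (?A (g h) \<inter> ?B h) \<omega>) \<partial>M)"
  proof (rule Bochner_Integration.integral_cong[OF refl])
    fix \<omega> assume \<omega>: "\<omega> \<in> space M"
    show "of_bool (X \<omega> \<le> g (Y \<omega>)) * w (Y \<omega>) = (\<Sum>h\<in>S. w h * indicator (?A (g h) \<inter> ?B h) \<omega>)"
      using \<omega> by (subst split[OF \<omega>, of "\<lambda>\<omega> h. of_bool (X \<omega> \<le> g h) * w h"])
        (auto intro!: sum.cong simp: indicator_def)
  qed
  also have "\<dots> = (\<Sum>h\<in>S. w h * prob (?A (g h) \<inter> ?B h))"
    using A B by (subst Bochner_Integration.integral_sum)
      (auto intro!: integrable_real_indicator integrable_mult_right simp: less_top[symmetric])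
  also have "\<dots> = (\<Sum>h\<in>S. w h * (prob (?A (g h)) * prob (?B h)))"
    using indep by simp
  also have "\<dots> \<le> (\<Sum>h\<in>S. w h * (g h * prob (?B h)))"
    using superuniform g w by (intro sum_mono mult_left_mono mult_right_mono) auto
  also have "\<dots> = (\<integral>\<omega>. (\<Sum>h\<in>S. (g h * w h) * indicator (?B h) \<omega>) \<partial>M)"
    using B by (subst Bochner_Integration.integral_sum)
      (auto intro!: integrable_real_indicator integrable_mult_right sum.cong simp: less_top[symmetric])
  also have "\<dots> = (\<integral>\<omega>. g (Y \<omega>) * w (Y \<omega>) \<partial>M)"
    by (rule Bochner_Integration.integral_cong[OF refl], subst split[of _ "\<lambda>_ h. g h * w h"]) auto
  finally show ?thesis .
qed

section \<open>Generated sigma-algebras\<close>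

lemma space_generated [simp]: "space (generated M X I) = space M"
  unfolding generated_def by (rule space_measure_of) auto

lemma measurable_generated:
  assumes "s \<in> I"
  shows "X s \<in> borel_measurable (generated M X I)"
proof (rule measurableI)
  fix B :: "real set" assume "B \<in> sets borel"
  then have "X s -` B \<inter> space M \<in> (\<Union>s\<in>I. {X s -` B \<inter> space M |B. B \<in> sets borel})"
    using assms by blast
  then show "X s -` B \<inter> space (generated M X I) \<in> sets (generated M X I)"
    unfolding space_generated unfolding generated_def by (subst sets_measure_of) auto
qed auto

lemma subalgebra_generated:
  assumes "\<And>s. s \<in> I \<Longrightarrow> X s \<in> borel_measurable M"
  shows "subalgebra M (generated M X I)"
proof -
  have "sigma_sets (space M) (\<Union>s\<in>I. {X s -` B \<inter> space M |B. B \<in> sets borel}) \<subseteq> sets M"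
    using assms by (intro sets.sigma_sets_subset) (auto intro: measurable_sets)
  moreover have "sets (generated M X I)
      = sigma_sets (space M) (\<Union>s\<in>I. {X s -` B \<inter> space M |B. B \<in> sets borel})"
    unfolding generated_def by (rule sets_measure_of) auto
  ultimately show ?thesis
    by (simp add: subalgebra_def)
qed

section \<open>Finite rejection histories\<close>

lemma finite_histories: "finite (histories t)"
  unfolding histories_def by (intro finite_PiE) auto

lemma restrict_histories:
  assumes "h \<in> histories n" "t \<le> n"
  shows "restrict h {1..<t} \<in> histories t"
  using assms unfolding histories_def by (auto simp: PiE_iff)

text \<open>There are finitely many histories, so preimages of singletons suffice, and each is a
  finite intersection of level sets. With the discrete target, composing with any function of the
  history, such as \<open>f t\<close>, stays measurable.\<close>

lemma measurable_history:
  fixes X :: "nat \<Rightarrow> 'a \<Rightarrow> real"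
  assumes X: "\<And>s. s \<in> {1..<n} \<Longrightarrow> X s \<in> borel_measurable N"
    and range: "\<And>s \<omega>. s \<in> {1..<n} \<Longrightarrow> \<omega> \<in> space N \<Longrightarrow> X s \<omega> \<in> {0, 1}"
  shows "(\<lambda>\<omega>. \<lambda>s\<in>{1..<n}. X s \<omega>) \<in> measurable N (count_space (histories n))"
proof (subst measurable_count_space_eq2[OF finite_histories], intro conjI ballI)
  show "(\<lambda>\<omega>. \<lambda>s\<in>{1..<n}. X s \<omega>) \<in> space N \<rightarrow> histories n"
    using range unfolding histories_def by (intro funcsetI) (simp add: PiE_iff)
next
  fix h assume h: "h \<in> histories n"
  have "(\<lambda>\<omega>. \<lambda>s\<in>{1..<n}. X s \<omega>) -` {h} \<inter> space N
      = {\<omega> \<in> space N. \<forall>s\<in>{1..<n}. X s \<omega> = h s}"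
    using h unfolding histories_def
    by (auto simp: PiE_iff extensional_def fun_eq_iff restrict_def)
  also have "\<dots> \<in> sets N"
    using X by (intro sets.sets_Collect_finite_All borel_measurable_eq) auto
  finally show "(\<lambda>\<omega>. \<lambda>s\<in>{1..<n}. X s \<omega>) -` {h} \<inter> space N \<in> sets N" .
qed

section \<open>Rejections as a deterministic function of a path of p-values\<close>

text \<open>The recursion below terminates because \<^const>\<open>restrict\<close> only evaluates times before \<open>t\<close>;
  \<open>fun\<close> sees this through the congruence rule.\<close>

declare restrict_cong [unfolded simp_implies_def, fundef_cong]

fun rej :: "(nat \<Rightarrow> (nat \<Rightarrow> real) \<Rightarrow> real) \<Rightarrow> (nat \<Rightarrow> real) \<Rightarrow> nat \<Rightarrow> real" where
  "rej f q t = (if q t \<le> f t (\<lambda>s\<in>{1..<t}. rej f q s) then 1 else 0)"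

declare rej.simps [simp del]

lemma rej_range: "rej f q t \<in> {0, 1}"
  by (subst rej.simps) simp

lemma rej_history: "(\<lambda>s\<in>{1..<t}. rej f q s) \<in> histories t"
  using rej_range unfolding histories_def by (auto simp: PiE_iff)

text \<open>Decisions look only at the past and present, so altering the p-value at one time cannot
  affect earlier decisions.\<close>

lemma rej_cong:
  assumes "\<And>s. s \<in> {1..t} \<Longrightarrow> q s = q' s" "t \<ge> 1"
  shows "rej f q t = rej f q' t"
  using assms
proof (induction t rule: less_induct)
  case (less t)
  have "(\<lambda>s\<in>{1..<t}. rej f q s) = (\<lambda>s\<in>{1..<t}. rej f q' s)"
    using less by (intro restrict_ext) auto
  then show ?case
    using less.prems by (subst (1 2) rej.simps) auto
qed

text \<open>Smaller p-values give, inductively, a larger history, hence a larger threshold, which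
  the smaller current p-value meets more easily.\<close>

lemma rej_antimono:
  assumes mono: "\<And>t. t \<ge> 1 \<Longrightarrow> coordwise_nondecreasing t (f t)"
    and le: "\<And>s. s \<ge> 1 \<Longrightarrow> q s \<le> q' s" and "t \<ge> 1"
  shows "rej f q' t \<le> rej f q t"
  using \<open>t \<ge> 1\<close>
proof (induction t rule: less_induct)
  case (less t)
  have "f t (\<lambda>s\<in>{1..<t}. rej f q' s) \<le> f t (\<lambda>s\<in>{1..<t}. rej f q s)"
    using mono[OF less.prems] less.IH rej_history
    unfolding coordwise_nondecreasing_def by auto
  then show ?case
    using le[OF less.prems] by (subst (1 2) rej.simps) auto
qed

text \<open>At time \<open>t\<close> the value 0 lies below the nonnegative threshold, so the
  rejection persists; every other time sees its old p-value and, by induction, its old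
  history.\<close>

lemma rej_upd_eq:
  assumes "rej f q t = 1" and nonneg: "\<And>r. r \<in> histories t \<Longrightarrow> 0 \<le> f t r" and "s \<ge> 1"
  shows "rej f (q(t := 0)) s = rej f q s"
  using \<open>s \<ge> 1\<close>
proof (induction s rule: less_induct)
  case (less s)
  show ?case
  proof (cases "s = t")
    case True
    have "rej f (q(t := 0)) t = 1"
      using nonneg[OF rej_history] by (subst rej.simps) simp
    with assms(1) show ?thesis by (simp only: True)
  next
    case False
    have "(\<lambda>r\<in>{1..<s}. rej f (q(t := 0)) r) = (\<lambda>r\<in>{1..<s}. rej f q r)"
      by (intro restrict_ext less.IH) auto
    with False show ?thesis
      by (subst (1 2) rej.simps) simp
  qed
qed

text \<open>The measure \<open>N\<close> is left general so that this applies both to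
  \<open>M\<close> and to the sigma-algebra generated by all p-values but one.\<close>

lemma measurable_rej:
  assumes X: "\<And>s. s \<ge> 1 \<Longrightarrow> X s \<in> borel_measurable N" and "t \<ge> 1"
  shows "(\<lambda>\<omega>. rej f (\<lambda>s. X s \<omega>) t) \<in> borel_measurable N"
  using \<open>t \<ge> 1\<close>
proof (induction t rule: less_induct)
  case (less t)
  have "(\<lambda>\<omega>. \<lambda>s\<in>{1..<t}. rej f (\<lambda>s. X s \<omega>) s) \<in> measurable N (count_space (histories t))"
    using less.IH rej_range by (intro measurable_history) auto
  then have [measurable]: "(\<lambda>\<omega>. f t (\<lambda>s\<in>{1..<t}. rej f (\<lambda>s. X s \<omega>) s)) \<in> borel_measurable N"
    by (rule measurable_compose) simp
  have [measurable]: "X t \<in> borel_measurable N"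
    using X less.prems .
  show ?case
    by (subst rej.simps) measurable
qed

text \<open>Integrating the conditional bound removes the conditioning; this yields marginal
  superuniformity of null p-values.\<close>

lemma (in prob_space) prob_le_of_cond_exp_le:
  assumes "subalgebra M F" and A: "A \<in> events"
    and le: "AE \<omega> in M. real_cond_exp M F (indicator A) \<omega> \<le> u"
  shows "prob A \<le> u"
proof -
  interpret finite_measure_subalgebra M F
    using assms(1) by unfold_locales
  have int: "integrable M (indicator A :: 'a \<Rightarrow> real)"
    using A by (simp add: less_top[symmetric])
  have "prob A = (\<integral>\<omega>. real_cond_exp M F (indicator A) \<omega> \<partial>M)"
    using real_cond_exp_int(2)[OF int] A by simp
  also have "\<dots> \<le> (\<integral>\<omega>. u \<partial>M)"
    using real_cond_exp_int(1)[OF int] le by (intro integral_mono_AE) auto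
  finally show ?thesis
    by (simp add: prob_space)
qed

theorem proposition1:
  fixes M :: "'a measure"
    and \<delta> \<eta> \<alpha> :: real
    and T :: nat
    and p a R :: "nat \<Rightarrow> 'a \<Rightarrow> real"
    and f :: "nat \<Rightarrow> (nat \<Rightarrow> real) \<Rightarrow> real"
    and H0 :: "nat set"
  assumes "prob_space M"
    and "0 < \<delta>" and "\<delta> \<le> 1"
    and "\<eta> > 0"
    and "0 \<le> \<alpha>" and "\<alpha> \<le> 1"
    and "T \<ge> 1"
    and p_rv: "\<And>t. t \<ge> 1 \<Longrightarrow> p t \<in> borel_measurable M"
    and p_range: "\<And>t \<omega>. t \<ge> 1 \<Longrightarrow> \<omega> \<in> space M \<Longrightarrow> p t \<omega> \<in> {0..1}"
    and H0: "H0 \<subseteq> {1..}"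
    and R: "R = rejection p a"
    and thresholds: "\<And>t \<omega>. t \<ge> 1 \<Longrightarrow> \<omega> \<in> space M \<Longrightarrow> a t \<omega> = f t (\<lambda>s\<in>{1..<t}. R s \<omega>)"
    and f_nonneg: "\<And>t r. t \<ge> 1 \<Longrightarrow> r \<in> histories t \<Longrightarrow> f t r \<ge> 0"
    and f_mono: "\<And>t. t \<ge> 1 \<Longrightarrow> coordwise_nondecreasing t (f t)"
    and null_indep: "\<And>t. t \<in> H0 \<Longrightarrow>
          prob_space.indep_set M (sets (generated M p {t})) (sets (generated M p ({1..} - {t})))"
    and null_superuniform: "\<And>t u. t \<in> H0 \<Longrightarrow> u \<in> {0..1} \<Longrightarrow>
          AE \<omega> in M. real_cond_exp M (generated M R {1..<t})
            (indicator {\<omega> \<in> space M. p t \<omega> \<le> u}) \<omega> \<le> u"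
    and FDP_bound: "AE \<omega> in M. FDP_LORD \<delta> \<eta> a R T \<omega> \<le> \<alpha>"
  shows "sFDR M \<delta> \<eta> H0 R T \<le> \<alpha>"
proof -
  interpret prob_space M by fact
  define q where "q \<omega> = (\<lambda>s. p s \<omega>)" for \<omega>
  \<comment> \<open>The denominator as a function of a rejection sequence, to be evaluated on the
    actual and on the modified history alike.\<close>
  define D where "D h = (\<Sum>s=1..T. \<delta> ^ (T - s) * h s) + \<eta>" for h :: "nat \<Rightarrow> real"
  have D_ge: "\<eta> \<le> D h" if "\<And>s. s \<in> {1..T} \<Longrightarrow> 0 \<le> h s" for h
    unfolding D_def using \<open>0 < \<delta>\<close> that by (auto intro!: sum_nonneg)
  have D_mono: "D h \<le> D h'" if "\<And>s. s \<in> {1..T} \<Longrightarrow> h s \<le> h' s" for h h'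
    unfolding D_def using \<open>0 < \<delta>\<close> that by (auto intro!: sum_mono mult_left_mono)
  have D_cong: "D h = D h'" if "\<And>s. s \<in> {1..T} \<Longrightarrow> h s = h' s" for h h'
    unfolding D_def using that by simp
  \<comment> \<open>Induction identifies the given rejections with the recursion run on the observed
    p-values, which gives meaning to changing one p-value and rerunning the procedure.\<close>
  have R_rej: "R s \<omega> = rej f (q \<omega>) s" if "\<omega> \<in> space M" "s \<ge> 1" for s \<omega>
    using \<open>s \<ge> 1\<close>
  proof (induction s rule: less_induct)
    case (less s)
    have "(\<lambda>r\<in>{1..<s}. R r \<omega>) = (\<lambda>r\<in>{1..<s}. rej f (q \<omega>) r)"
      using less by (intro restrict_ext) auto
    then have "a s \<omega> = f s (\<lambda>r\<in>{1..<s}. rej f (q \<omega>) r)"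
      using thresholds[OF less.prems that(1)] by simp
    then show ?case
      by (subst rej.simps) (simp add: R rejection_def q_def)
  qed
  have a_rej: "a s \<omega> = f s (\<lambda>r\<in>{1..<s}. rej f (q \<omega>) r)" if "\<omega> \<in> space M" "s \<ge> 1" for s \<omega>
  proof -
    have "(\<lambda>r\<in>{1..<s}. R r \<omega>) = (\<lambda>r\<in>{1..<s}. rej f (q \<omega>) r)"
      using R_rej that by (intro restrict_ext) auto
    then show ?thesis
      using thresholds that by simp
  qed
  have R_meas: "R s \<in> borel_measurable M" if "s \<ge> 1" for s
  proof -
    have "(\<lambda>\<omega>. rej f (q \<omega>) s) \<in> borel_measurable M"
      unfolding q_def using p_rv that by (rule measurable_rej)
    then show ?thesis
      using R_rej that by (subst measurable_cong) auto
  qed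
  have R_range: "R s \<omega> \<in> {0, 1}" for s \<omega>
    by (simp add: R rejection_def)
  have R_hist: "(\<lambda>\<omega>. \<lambda>r\<in>{1..<s}. R r \<omega>) \<in> measurable M (count_space (histories s))" for s
    using R_meas R_range by (intro measurable_history) auto
  have a_meas: "a s \<in> borel_measurable M" if "s \<ge> 1" for s
  proof -
    have "(\<lambda>\<omega>. f s (\<lambda>r\<in>{1..<s}. R r \<omega>)) \<in> borel_measurable M"
      using R_hist by (rule measurable_compose) simp
    then show ?thesis
      using thresholds that by (subst measurable_cong) auto
  qed
  have a_nonneg: "0 \<le> a s \<omega>" if "\<omega> \<in> space M" "s \<ge> 1" for s \<omega>
    using a_rej that f_nonneg rej_history by simp
  \<comment> \<open>A crude constant bound on the thresholds, enough for integrability: a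
    nonnegative function on a finite set is at most its total.\<close>
  have f_bound: "f s r \<le> (\<Sum>r\<in>histories s. f s r)" if "s \<ge> 1" "r \<in> histories s" for s r
    using that f_nonneg finite_histories by (intro member_le_sum) auto
  let ?W = "\<lambda>\<omega>. mem_rejections \<delta> R T \<omega> + \<eta>"
  have W_D: "?W \<omega> = D (\<lambda>s. R s \<omega>)" for \<omega>
    by (simp add: D_def mem_rejections_def)
  have W_ge: "\<eta> \<le> ?W \<omega>" for \<omega>
    unfolding W_D using R_range by (intro D_ge) (metis insert_iff order_refl singletonD zero_le_one)
  have W_meas [measurable]: "?W \<in> borel_measurable M"
    unfolding mem_rejections_def using R_meas by (intro borel_measurable_add borel_measurable_sum) auto
  have quot_bound: "\<bar>x / ?W \<omega>\<bar> \<le> c / \<eta>" if "0 \<le> x" "x \<le> c" for x c \<omega>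
    using that W_ge[of \<omega>] \<open>\<eta> > 0\<close> by (simp add: frac_le)
  have int_R: "integrable M (\<lambda>\<omega>. R s \<omega> / ?W \<omega>)" if "s \<ge> 1" for s
  proof (rule integrable_const_bound[where B = "1 / \<eta>"])
    show "AE \<omega> in M. norm (R s \<omega> / ?W \<omega>) \<le> 1 / \<eta>"
      unfolding real_norm_def by (intro AE_I2 quot_bound) (simp_all add: R rejection_def)
  qed (use R_meas that in measurable)
  have int_a: "integrable M (\<lambda>\<omega>. a s \<omega> / ?W \<omega>)" if "s \<ge> 1" for s
  proof (rule integrable_const_bound[where B = "(\<Sum>r\<in>histories s. f s r) / \<eta>"])
    show "AE \<omega> in M. norm (a s \<omega> / ?W \<omega>) \<le> (\<Sum>r\<in>histories s. f s r) / \<eta>"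
      unfolding real_norm_def using a_nonneg that
      by (intro AE_I2 quot_bound) (auto simp: a_rej simp del: One_nat_def intro!: f_bound rej_history)
  qed (use a_meas that in measurable)
  \<comment> \<open>Thresholds may exceed 1, so the bound is extended from \<open>[0,1]\<close> to
    all \<open>u \<ge> 0\<close>; beyond 1 it is trivial.\<close>
  have null_prob: "prob {\<omega> \<in> space M. p t \<omega> \<le> u} \<le> u" if t: "t \<in> H0" and "0 \<le> u" for t u
  proof (cases "u \<le> 1")
    case True
    have [measurable]: "p t \<in> borel_measurable M"
      using p_rv H0 t by auto
    have "subalgebra M (generated M R {1..<t})"
      using R_meas by (intro subalgebra_generated) auto
    then show ?thesis
      using null_superuniform[OF t] True \<open>0 \<le> u\<close> by (intro prob_le_of_cond_exp_le) auto
  next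
    case False
    then show ?thesis using prob_le_1 by (meson order_trans linear)
  qed

  \<comment> \<open>Leave-one-out inequality at a null time\<close>
  have key: "(\<integral>\<omega>. R t \<omega> / ?W \<omega> \<partial>M) \<le> (\<integral>\<omega>. a t \<omega> / ?W \<omega> \<partial>M)" if t: "t \<in> H0" "t \<le> T" for t
  proof -
    have t1: "t \<ge> 1" using t H0 by auto
    define q' where "q' \<omega> = (q \<omega>)(t := 0)" for \<omega>
    \<comment> \<open>\<open>Y\<close> is the modified history through time \<open>T\<close>, whence
      \<open>Suc T\<close>; \<open>g\<close> recovers the threshold at \<open>t\<close> from its
      first \<open>t - 1\<close> entries.\<close>
    define Y where "Y \<omega> = (\<lambda>s\<in>{1..<Suc T}. rej f (q' \<omega>) s)" for \<omega>
    define g where "g h = f t (restrict h {1..<t})" for h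
    let ?F = "generated M p ({1..} - {t})"
    have sub: "subalgebra M ?F"
      using p_rv by (intro subalgebra_generated) auto
    \<comment> \<open>The coordinate \<open>t\<close> of \<open>q'\<close> is constantly 0, so
      \<open>q'\<close>, and with it \<open>Y\<close>, depends only on the other p-values.\<close>
    have q'_meas: "(\<lambda>\<omega>. q' \<omega> s) \<in> borel_measurable ?F" if "s \<ge> 1" for s
      using that measurable_generated[of s "{1..} - {t}" p M]
      by (cases "s = t") (auto simp: q'_def q_def)
    have Y_meas_F: "Y \<in> measurable ?F (count_space (histories (Suc T)))"
      unfolding Y_def using measurable_rej[where X = "\<lambda>s \<omega>. q' \<omega> s", OF q'_meas] rej_range
      by (intro measurable_history) auto
    then have Y_meas: "Y \<in> measurable M (count_space (histories (Suc T)))"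
      by (rule measurable_from_subalg[OF sub])
    have gY: "g (Y \<omega>) = a t \<omega>" if "\<omega> \<in> space M" for \<omega>
    proof -
      have "restrict (Y \<omega>) {1..<t} = (\<lambda>r\<in>{1..<t}. rej f (q \<omega>) r)"
      proof (rule ext)
        fix r
        show "restrict (Y \<omega>) {1..<t} r = (\<lambda>r\<in>{1..<t}. rej f (q \<omega>) r) r"
          using t(2) by (auto simp: Y_def q'_def intro!: rej_cong)
      qed
      then show ?thesis
        using a_rej that t1 by (simp add: g_def)
    qed
    have D_Y: "D (Y \<omega>) = D (rej f (q' \<omega>))" for \<omega>
      by (intro D_cong) (simp add: Y_def)
    \<comment> \<open>Since p-values are nonnegative, setting one to 0 lowers the path, and
      rejections can only be gained.\<close>
    have D_le: "?W \<omega> \<le> D (Y \<omega>)" if "\<omega> \<in> space M" for \<omega>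
      unfolding W_D D_Y
    proof (rule D_mono)
      fix s assume "s \<in> {1..T}"
      then show "R s \<omega> \<le> rej f (q' \<omega>) s"
        using R_rej that p_range[OF t1] f_mono
        by (auto intro!: rej_antimono simp: q'_def q_def)
    qed
    have D_eq: "?W \<omega> = D (Y \<omega>)" if "\<omega> \<in> space M" "p t \<omega> \<le> a t \<omega>" for \<omega>
    proof -
      have "rej f (q \<omega>) t = 1"
        using R_rej[of \<omega> t] that t1 by (simp add: R rejection_def)
      then have "rej f (q' \<omega>) s = rej f (q \<omega>) s" if "s \<ge> 1" for s
        unfolding q'_def using f_nonneg t1 that by (intro rej_upd_eq) auto
      then show ?thesis
        unfolding W_D D_Y using R_rej that by (intro D_cong) auto
    qed
    \<comment> \<open>Without a rejection at \<open>t\<close> both integrands vanish; with one,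
      \<open>D_eq\<close> makes the denominators agree.\<close>
    have "(\<integral>\<omega>. R t \<omega> / ?W \<omega> \<partial>M)
        = (\<integral>\<omega>. of_bool (p t \<omega> \<le> g (Y \<omega>)) * (1 / D (Y \<omega>)) \<partial>M)"
      using D_eq gY by (intro Bochner_Integration.integral_cong) (auto simp: R rejection_def)
    also have "\<dots> \<le> (\<integral>\<omega>. g (Y \<omega>) * (1 / D (Y \<omega>)) \<partial>M)"
    proof (rule expectation_threshold_le[OF _ Y_meas finite_histories])
      show "p t \<in> borel_measurable M" using p_rv t1 .
      show "0 \<le> g h" if "h \<in> histories (Suc T)" for h
        unfolding g_def using t(2) t1 by (intro f_nonneg restrict_histories[OF that]) auto
      show "0 \<le> 1 / D h" if "h \<in> histories (Suc T)" for h
      proof -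
        have "h s \<in> {0, 1}" if "s \<in> {1..T}" for s
          using \<open>h \<in> histories (Suc T)\<close> that by (simp add: histories_def PiE_iff)
        then have "\<eta> \<le> D h"
          by (intro D_ge) (metis insert_iff order_refl singletonD zero_le_one)
        with \<open>\<eta> > 0\<close> show ?thesis by simp
      qed
      show "prob {\<omega> \<in> space M. p t \<omega> \<le> u} \<le> u" if "0 \<le> u" for u
        using null_prob t(1) that .
      show "prob ({\<omega> \<in> space M. p t \<omega> \<le> u} \<inter> {\<omega> \<in> space M. Y \<omega> = h})
          = prob {\<omega> \<in> space M. p t \<omega> \<le> u} * prob {\<omega> \<in> space M. Y \<omega> = h}"
        if h: "h \<in> histories (Suc T)" for h u
      proof (rule indep_setD[OF null_indep[OF t(1)]])
        have "p t -` {..u} \<inter> space M \<in> sets (generated M p {t})"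
          using measurable_sets[OF measurable_generated[of t "{t}" p M], of "{..u}"] by simp
        also have "p t -` {..u} \<inter> space M = {\<omega> \<in> space M. p t \<omega> \<le> u}" by auto
        finally show "{\<omega> \<in> space M. p t \<omega> \<le> u} \<in> sets (generated M p {t})" .
        have "Y -` {h} \<inter> space M \<in> sets ?F"
          using measurable_sets[OF Y_meas_F, of "{h}"] h by simp
        also have "Y -` {h} \<inter> space M = {\<omega> \<in> space M. Y \<omega> = h}" by auto
        finally show "{\<omega> \<in> space M. Y \<omega> = h} \<in> sets ?F" .
      qed
    qed
    \<comment> \<open>Back to the actual denominator: it is positive and at most the modified one,
      and the numerator \<open>a t \<omega>\<close> is nonnegative.\<close>
    also have "\<dots> \<le> (\<integral>\<omega>. a t \<omega> / ?W \<omega> \<partial>M)"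
    proof (rule integral_mono')
      show "integrable M (\<lambda>\<omega>. a t \<omega> / ?W \<omega>)" using int_a t1 .
      fix \<omega> assume \<omega>: "\<omega> \<in> space M"
      have "0 < ?W \<omega>" using W_ge[of \<omega>] \<open>\<eta> > 0\<close> by linarith
      then show "g (Y \<omega>) * (1 / D (Y \<omega>)) \<le> a t \<omega> / ?W \<omega>" "0 \<le> a t \<omega> / ?W \<omega>"
        using D_le[OF \<omega>] a_nonneg[OF \<omega> t1] gY[OF \<omega>] by (simp_all add: divide_left_mono)
    qed
    finally show ?thesis .
  qed

  \<comment> \<open>Summation over time and comparison with the LORD estimate\<close>
  have "sFDR M \<delta> \<eta> H0 R T
      = (\<integral>\<omega>. (\<Sum>t=1..T. \<delta> ^ (T - t) * indicator H0 t * (R t \<omega> / ?W \<omega>)) \<partial>M)"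
    unfolding sFDR_def mem_false_positives_def sum_divide_distrib by (simp only: mult_ac times_divide_eq_right)
  also have "\<dots> = (\<Sum>t=1..T. \<delta> ^ (T - t) * indicator H0 t * (\<integral>\<omega>. R t \<omega> / ?W \<omega> \<partial>M))"
    using int_R by (subst Bochner_Integration.integral_sum) (auto simp del: times_divide_eq_right)
  \<comment> \<open>Null times use \<open>key\<close>; at the other times the left summand is 0 and
    the right one nonnegative.\<close>
  also have "\<dots> \<le> (\<Sum>t=1..T. \<delta> ^ (T - t) * (\<integral>\<omega>. a t \<omega> / ?W \<omega> \<partial>M))"
  proof (rule sum_mono)
    fix t assume t: "t \<in> {1..T}"
    have "0 \<le> a t \<omega> / ?W \<omega>" if "\<omega> \<in> space M" for \<omega>
      using a_nonneg[OF that, of t] t W_ge[of \<omega>] \<open>\<eta> > 0\<close> by simp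
    then have "0 \<le> (\<integral>\<omega>. a t \<omega> / ?W \<omega> \<partial>M)"
      by (rule Bochner_Integration.integral_nonneg)
    then show "\<delta> ^ (T - t) * indicator H0 t * (\<integral>\<omega>. R t \<omega> / ?W \<omega> \<partial>M)
        \<le> \<delta> ^ (T - t) * (\<integral>\<omega>. a t \<omega> / ?W \<omega> \<partial>M)"
      using key[of t] t \<open>0 < \<delta>\<close> by (cases "t \<in> H0") auto
  qed
  also have "\<dots> = (\<integral>\<omega>. (\<Sum>t=1..T. \<delta> ^ (T - t) * (a t \<omega> / ?W \<omega>)) \<partial>M)"
    using int_a by (subst Bochner_Integration.integral_sum) (auto simp del: times_divide_eq_right)
  also have "\<dots> = (\<integral>\<omega>. FDP_LORD \<delta> \<eta> a R T \<omega> \<partial>M)"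
    unfolding FDP_LORD_def by (simp add: sum_divide_distrib)
  also have "\<dots> \<le> (\<integral>\<omega>. \<alpha> \<partial>M)"
  proof (rule integral_mono_AE)
    show "integrable M (FDP_LORD \<delta> \<eta> a R T)"
    proof -
      have "integrable M (\<lambda>\<omega>. \<Sum>t=1..T. \<delta> ^ (T - t) * (a t \<omega> / ?W \<omega>))"
        using int_a by (intro Bochner_Integration.integrable_sum) (auto simp del: times_divide_eq_right)
      then show ?thesis
        by (simp add: FDP_LORD_def[abs_def] sum_divide_distrib)
    qed
  qed (use FDP_bound in simp_all)
  finally show ?thesis
    by (simp add: prob_space)
qed

end
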